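(* Let $R$ be a countable integral domain. The affine semigroup $\mathcal{A}_R$ is amenable if and only if $R$ is a field.
   Context: The affine semigroup $\mathcal{A}_R$ is the semigroup, under composition, of all maps $R\to R$ of the form $x\mapsto ux+v$ with $u\in R\setminus\{0\}$, $v\in R$. A (discrete) semigroup $G$ is called amenable here if it is left amenable: there is a finitely additive probability measure $m$ defined on all subsets of $G$ such that $m(\{h\in G:gh\in E\})=m(E)$ for all $g\in G$ and $E\subset G$. *)

theory Defs
  imports Complex_Main "HOL-Algebra.Ring" "HOL-Library.Countable_Set" "HOL-Library.FuncSet"
begin

(* Self-maps of the carrier are represented by extensional functions, so that two maps are
   equal iff they agree on the carrier. *)
definition affine_map :: "('a, 'm) ring_scheme \<Rightarrow> 'a \<Rightarrow> 'a \<Rightarrow> 'a \<Rightarrow> 'a" where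
  "affine_map R u v = (\<lambda>x\<in>carrier R. u \<otimes>\<^bsub>R\<^esub> x \<oplus>\<^bsub>R\<^esub> v)"

definition affine_semigroup :: "('a, 'm) ring_scheme \<Rightarrow> ('a \<Rightarrow> 'a) monoid" where
  "affine_semigroup R =
    \<lparr>carrier = {affine_map R u v | u v. u \<in> carrier R - {\<zero>\<^bsub>R\<^esub>} \<and> v \<in> carrier R},
     mult = compose (carrier R),
     one = (\<lambda>x\<in>carrier R. x)\<rparr>"

lemma (in domain) monoid_affine_semigroup: "monoid (affine_semigroup R)"
proof (rule monoidI)
  let ?A = "affine_semigroup R"
  fix f g h
  assume "f \<in> carrier ?A"
  then obtain a b where f: "f = affine_map R a b" "a \<in> carrier R - {\<zero>}" "b \<in> carrier R"
    by (auto simp: affine_semigroup_def)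
  show "\<one>\<^bsub>?A\<^esub> \<otimes>\<^bsub>?A\<^esub> f = f" "f \<otimes>\<^bsub>?A\<^esub> \<one>\<^bsub>?A\<^esub> = f"
    using f by (auto simp: affine_semigroup_def affine_map_def compose_def restrict_def)
  assume "g \<in> carrier ?A"
  then obtain c d where g: "g = affine_map R c d" "c \<in> carrier R - {\<zero>}" "d \<in> carrier R"
    by (auto simp: affine_semigroup_def)
  have "f \<otimes>\<^bsub>?A\<^esub> g = affine_map R (a \<otimes> c) (a \<otimes> d \<oplus> b)"
    using f g by (auto simp: affine_semigroup_def affine_map_def compose_def fun_eq_iff
        r_distr m_assoc a_assoc)
  then show "f \<otimes>\<^bsub>?A\<^esub> g \<in> carrier ?A"
    using f g integral by (auto simp: affine_semigroup_def)
  assume "h \<in> carrier ?A"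
  then have "h \<in> carrier R \<rightarrow> carrier R"
    by (auto simp: affine_semigroup_def affine_map_def)
  then show "f \<otimes>\<^bsub>?A\<^esub> g \<otimes>\<^bsub>?A\<^esub> h = f \<otimes>\<^bsub>?A\<^esub> (g \<otimes>\<^bsub>?A\<^esub> h)"
    by (auto simp: affine_semigroup_def compose_def fun_eq_iff restrict_def)
next
  have "(\<lambda>x\<in>carrier R. x) = affine_map R \<one> \<zero>"
    by (auto simp: affine_map_def)
  then show "\<one>\<^bsub>affine_semigroup R\<^esub> \<in> carrier (affine_semigroup R)"
    using one_not_zero one_closed zero_closed unfolding affine_semigroup_def by (simp, blast)
qed

definition finitely_additive_prob :: "'a set \<Rightarrow> ('a set \<Rightarrow> real) \<Rightarrow> bool" where
  "finitely_additive_prob X m \<longleftrightarrow>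
    (\<forall>A. A \<subseteq> X \<longrightarrow> 0 \<le> m A) \<and>
    m X = 1 \<and>
    (\<forall>A B. A \<subseteq> X \<longrightarrow> B \<subseteq> X \<longrightarrow> A \<inter> B = {} \<longrightarrow> m (A \<union> B) = m A + m B)"

(* Left amenability. Only the carrier and the multiplication of the record are used, so this
   is a notion about (discrete) semigroups; the unit plays no role. *)
definition amenable :: "('a, 'm) monoid_scheme \<Rightarrow> bool" where
  "amenable G \<longleftrightarrow>
    (\<exists>m. finitely_additive_prob (carrier G) m \<and>
      (\<forall>g\<in>carrier G. \<forall>E. E \<subseteq> carrier G \<longrightarrow>
        m {h \<in> carrier G. g \<otimes>\<^bsub>G\<^esub> h \<in> E} = m E))"

end

theory Submission
  imports Defs "HOL-Analysis.Function_Topology"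
begin

text \<open>
  If \<open>u\<close> is a nonzero non-unit of \<open>R\<close>, then the right ideals of the affine semigroup generated by
  \<open>x \<mapsto> u x\<close> and \<open>x \<mapsto> u x + 1\<close> are disjoint (evaluate at \<open>0\<close>), although an invariant mean would
  give measure one to both.

  Conversely let \<open>R\<close> be a field. Averaging over the powers of one element at a time yields means on
  a commutative monoid that are invariant under finitely many elements up to a given error, and
  Tychonoff's theorem turns approximate into exact invariance of measures. This gives an invariant
  measure \<open>\<mu>\<close> on the additive group. Integrating \<open>\<mu> {v. (x \<mapsto> u (x + v)) \<in> E}\<close> over \<open>u\<close> against an
  approximate mean on the multiplicative group gives an approximately invariant measure on the
  affine group, because left multiplication by \<open>x \<mapsto> a x + b\<close> replaces \<open>u\<close> by \<open>a u\<close> and translates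
  \<open>v\<close>. A second use of compactness finishes the proof.
\<close>

section \<open>Compactness: from approximate to exact invariance\<close>

lemma finitely_additive_prob_le_1:
  assumes "finitely_additive_prob X m" "A \<subseteq> X"
  shows "m A \<le> 1"
proof -
  have "0 \<le> m (X - A)" "m X = 1"
    using assms unfolding finitely_additive_prob_def by auto
  moreover have "m (A \<union> (X - A)) = m A + m (X - A)"
    using assms unfolding finitely_additive_prob_def by (metis Diff_disjoint Diff_subset)
  ultimately show ?thesis
    using assms(2) by (simp add: Un_absorb1)
qed

lemma compact_unit_cube: "compact (UNIV \<rightarrow>\<^sub>E {0..1::real} :: ('a \<Rightarrow> real) set)"
proof -
  have "compactin (product_topology (\<lambda>_::'a. euclidean) UNIV) (UNIV \<rightarrow>\<^sub>E {0..1::real})"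
    by (simp add: compactin_PiE)
  then show ?thesis
    by (simp add: euclidean_product_topology)
qed

text \<open>Set functions with values in [0,1] form a compact cube. Each condition defining
  \<open>C (g, e)\<close> is an equation or weak inequality between finitely many coordinates, so
  \<open>C (g, e)\<close> is closed, and \<open>approx\<close> supplies the finite intersection
  property. A point common to all of them has invariance error below every positive
  \<open>e\<close>.\<close>

lemma amenable_if_almost_invariant:
  fixes G :: "('a, 'm) monoid_scheme"
  assumes approx: "\<And>F e. finite F \<Longrightarrow> F \<subseteq> carrier G \<Longrightarrow> 0 < e \<Longrightarrow>
    \<exists>m. finitely_additive_prob (carrier G) m \<and>
      (\<forall>g\<in>F. \<forall>E\<subseteq>carrier G. \<bar>m {h \<in> carrier G. g \<otimes>\<^bsub>G\<^esub> h \<in> E} - m E\<bar> \<le> e)"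
  shows "amenable G"
proof -
  let ?X = "carrier G"
  let ?K = "UNIV \<rightarrow>\<^sub>E {0..1::real} :: ('a set \<Rightarrow> real) set"
  define C where "C = (\<lambda>(g, e). {m. finitely_additive_prob ?X m \<and>
    (\<forall>E\<subseteq>?X. \<bar>m {h \<in> ?X. g \<otimes>\<^bsub>G\<^esub> h \<in> E} - m E\<bar> \<le> e)})"
  have cont: "continuous_on UNIV (\<lambda>m::'a set \<Rightarrow> real. m A)" for A
    by simp
  have "?K \<inter> (\<Inter>i\<in>?X \<times> {0<..}. C i) \<noteq> {}"
  proof (rule compact_imp_fip_image[OF compact_unit_cube])
    fix i :: "'a \<times> real"
    obtain g e where i: "i = (g, e)" by force
    show "closed (C i)"
      unfolding i C_def finitely_additive_prob_def case_prod_conv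
      by (intro closed_Collect_conj closed_Collect_all closed_Collect_imp closed_Collect_le
        closed_Collect_eq continuous_intros cont) auto
  next
    fix I :: "('a \<times> real) set"
    assume I: "finite I" "I \<subseteq> ?X \<times> {0<..}"
    \<comment> \<open>The inserted \<open>1\<close> keeps the minimum defined when \<open>I\<close>
      is empty.\<close>
    define e where "e = Min (insert 1 (snd ` I))"
    have "0 < e"
      using I unfolding e_def by (subst Min_gr_iff) auto
    have e_le: "e \<le> snd i" if "i \<in> I" for i
      using that I unfolding e_def by (intro Min_le) auto
    have "finite (fst ` I)" "fst ` I \<subseteq> ?X"
      using I by auto
    from approx[OF this \<open>0 < e\<close>] obtain m where m: "finitely_additive_prob ?X m"
      and inv: "\<And>g E. g \<in> fst ` I \<Longrightarrow> E \<subseteq> ?X \<Longrightarrow> \<bar>m {h \<in> ?X. g \<otimes>\<^bsub>G\<^esub> h \<in> E} - m E\<bar> \<le> e"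
      by blast
    \<comment> \<open>The cube has a coordinate for every set of the type, while \<open>m\<close> is
      unconstrained on sets outside \<open>?X\<close>; intersecting with \<open>?X\<close> brings
      all values into [0,1].\<close>
    define m' where "m' = (\<lambda>A. m (A \<inter> ?X))"
    have m'_eq: "m' A = m A" if "A \<subseteq> ?X" for A
      using that by (simp add: m'_def Int_absorb2)
    have "finitely_additive_prob ?X m'"
      using m unfolding finitely_additive_prob_def by (simp add: m'_eq)
    moreover have "m' \<in> ?K"
      using m finitely_additive_prob_le_1[OF m]
      by (auto simp: m'_def finitely_additive_prob_def)
    moreover have "\<bar>m' {h \<in> ?X. g \<otimes>\<^bsub>G\<^esub> h \<in> E} - m' E\<bar> \<le> d" if "(g, d) \<in> I" "E \<subseteq> ?X" for g d E
    proof -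
      have "g \<in> fst ` I" "e \<le> d"
        using that e_le[of "(g, d)"] by (auto simp: rev_image_eqI)
      then show ?thesis
        using inv[of g E] that by (simp add: m'_eq)
    qed
    ultimately show "?K \<inter> (\<Inter>i\<in>I. C i) \<noteq> {}"
      unfolding C_def by blast
  qed
  then obtain m where m: "m \<in> C (g, e)" if "g \<in> ?X" "0 < e" for g e
    by blast
  have "m {h \<in> ?X. g \<otimes>\<^bsub>G\<^esub> h \<in> E} = m E" if "g \<in> ?X" "E \<subseteq> ?X" for g E
  proof -
    have "\<bar>m {h \<in> ?X. g \<otimes>\<^bsub>G\<^esub> h \<in> E} - m E\<bar> \<le> 0 + e" if "0 < e" for e
      using m[OF \<open>g \<in> ?X\<close> that] \<open>E \<subseteq> ?X\<close> by (simp add: C_def)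
    then have "\<bar>m {h \<in> ?X. g \<otimes>\<^bsub>G\<^esub> h \<in> E} - m E\<bar> \<le> 0"
      by (rule field_le_epsilon)
    then show ?thesis by simp
  qed
  moreover have "finitely_additive_prob ?X m"
  proof (cases "?X = {}")
    \<comment> \<open>With no index pairs nothing is known about \<open>m\<close>. However,
      \<open>approx\<close> is contradictory here: a probability on the empty set would give it
      measure 1, whereas additivity forces 0.\<close>
    case True
    then show ?thesis
      using approx[of "{}" 1] by (auto simp: finitely_additive_prob_def)
  next
    case False
    then show ?thesis
      using m[of _ 1] by (auto simp: C_def)
  qed
  ultimately show ?thesis
    unfolding amenable_def by blast
qed

section \<open>Almost invariant means on commutative monoids\<close>

text \<open>Only averages over finite families occur as means, so linearity on unbounded functions is
  harmless.\<close>
definition mean_on :: "'a set \<Rightarrow> (('a \<Rightarrow> real) \<Rightarrow> real) \<Rightarrow> bool" where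
  "mean_on X M \<longleftrightarrow>
    (\<forall>f. (\<forall>x\<in>X. 0 \<le> f x) \<longrightarrow> 0 \<le> M f) \<and>
    M (\<lambda>_. 1) = 1 \<and>
    (\<forall>f g. M (\<lambda>x. f x + g x) = M f + M g)"

lemma mean_on_mono:
  assumes M: "mean_on X M" and le: "\<And>x. x \<in> X \<Longrightarrow> f x \<le> g x"
  shows "M f \<le> M g"
proof -
  have "\<forall>f g. M (\<lambda>x. f x + g x) = M f + M g"
    using M unfolding mean_on_def by blast
  from this[rule_format, of f "\<lambda>x. g x - f x"]
  have "M g = M f + M (\<lambda>x. g x - f x)"
    by simp
  moreover have "0 \<le> M (\<lambda>x. g x - f x)"
    using M le unfolding mean_on_def by simp
  ultimately show ?thesis by simp
qed

lemma mean_on_cong: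
  assumes "mean_on X M" "\<And>x. x \<in> X \<Longrightarrow> f x = g x"
  shows "M f = M g"
  using assms by (intro antisym mean_on_mono[of X M]) auto

text \<open>To add \<open>h\<close> to \<open>F\<close>, average \<open>M\<close> over the
  translates by the first \<open>n\<close> powers of \<open>h\<close>. A shift by \<open>h\<close>
  telescopes, leaving two end terms in [0,1] and an error of at most 1/n. By commutativity each
  \<open>g\<close> in \<open>F\<close> passes the powers of \<open>h\<close>, so averaging keeps the
  old error.\<close>

lemma (in comm_monoid) almost_invariant_mean:
  assumes "finite F" "F \<subseteq> carrier G" "0 < (e::real)"
  shows "\<exists>M. mean_on (carrier G) M \<and>
    (\<forall>g\<in>F. \<forall>f. (\<forall>x\<in>carrier G. f x \<in> {0..1}) \<longrightarrow> \<bar>M (\<lambda>x. f (g \<otimes> x)) - M f\<bar> \<le> e)"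
  using assms(1,2)
proof (induction F rule: finite_induct)
  case empty
  have "mean_on (carrier G) (\<lambda>f. f \<one>)"
    by (auto simp: mean_on_def)
  then show ?case by blast
next
  case (insert h F)
  then have h: "h \<in> carrier G" and F: "F \<subseteq> carrier G" by auto
  obtain M where M: "mean_on (carrier G) M"
    and inv: "\<And>g f. g \<in> F \<Longrightarrow> (\<And>x. x \<in> carrier G \<Longrightarrow> f x \<in> {0..1}) \<Longrightarrow>
      \<bar>M (\<lambda>x. f (g \<otimes> x)) - M f\<bar> \<le> e"
    using insert.IH[OF F] by blast
  obtain n :: nat where "1 / e < n"
    using reals_Archimedean2 by blast
  moreover have "0 < 1 / e"
    using assms(3) by simp
  ultimately have n: "0 < n" "1 \<le> e * n"
    using assms(3) by (auto simp: field_simps intro: gr0I)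
  define S where "S = (\<lambda>f k. M (\<lambda>x. f (h [^] (k::nat) \<otimes> x)))"
  define N where "N = (\<lambda>f. (\<Sum>k<n. S f k) / n)"
  have "mean_on (carrier G) N"
    using M n h
    by (auto simp: mean_on_def N_def S_def sum.distrib add_divide_distrib
        intro!: divide_nonneg_nonneg sum_nonneg)
  moreover have "\<bar>N (\<lambda>x. f (g \<otimes> x)) - N f\<bar> \<le> e"
    if g: "g \<in> insert h F" and f: "\<forall>x\<in>carrier G. f x \<in> {0..1}" for g f
  proof (cases "g = h")
    case True
    have "S (\<lambda>x. f (h \<otimes> x)) k = S f (Suc k)" for k
      unfolding S_def using h by (intro mean_on_cong[OF M]) (simp add: m_ac)
    then have "(\<Sum>k<n. S (\<lambda>x. f (h \<otimes> x)) k) - (\<Sum>k<n. S f k) = S f n - S f 0"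
      by (simp add: sum_lessThan_telescope flip: sum_subtractf)
    moreover have "S f k \<in> {0..1}" for k
    proof -
      have "S f k \<le> M (\<lambda>_. 1)"
        unfolding S_def using h f by (intro mean_on_mono[OF M]) auto
      moreover have "0 \<le> S f k"
        using M h f by (simp add: S_def mean_on_def)
      ultimately show ?thesis
        using M by (simp add: mean_on_def)
    qed
    from this[of n] this[of 0] have "\<bar>S f n - S f 0\<bar> \<le> 1"
      by auto
    ultimately have "\<bar>N (\<lambda>x. f (h \<otimes> x)) - N f\<bar> \<le> 1 / n"
      unfolding N_def by (simp add: divide_right_mono flip: diff_divide_distrib)
    also have "\<dots> \<le> e"
      using n by (simp add: field_simps)
    finally show ?thesis
      using True by simp
  next
    case False
    with g F have g: "g \<in> F" "g \<in> carrier G" by auto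
    have step: "\<bar>S (\<lambda>x. f (g \<otimes> x)) k - S f k\<bar> \<le> e" for k
    proof -
      \<comment> \<open>Once \<open>g\<close> stands next to \<open>x\<close>, the bound for
        \<open>M\<close> applies to the translate of \<open>f\<close> by a power of
        \<open>h\<close>, which still has values in [0,1].\<close>
      have "S (\<lambda>x. f (g \<otimes> x)) k = M (\<lambda>x. f (h [^] k \<otimes> (g \<otimes> x)))"
        unfolding S_def using g h by (intro mean_on_cong[OF M]) (simp add: m_lcomm)
      then show ?thesis
        using inv[of g "\<lambda>x. f (h [^] k \<otimes> x)"] g h f by (simp add: S_def)
    qed
    have "\<bar>\<Sum>k<n. S (\<lambda>x. f (g \<otimes> x)) k - S f k\<bar> \<le> (\<Sum>k<n. e)"
      by (rule order.trans[OF sum_abs sum_mono[OF step]])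
    then have "\<bar>\<Sum>k<n. S (\<lambda>x. f (g \<otimes> x)) k - S f k\<bar> / n \<le> e"
      using n by (simp add: field_simps)
    then show ?thesis
      unfolding N_def by (simp add: sum_subtractf flip: diff_divide_distrib)
  qed
  ultimately show ?case by blast
qed

lemma mean_on_imp_finitely_additive_prob:
  assumes "mean_on X M"
  shows "finitely_additive_prob X (\<lambda>A. M (\<lambda>x. of_bool (x \<in> A)))"
  unfolding finitely_additive_prob_def
proof (intro conjI allI impI)
  show "0 \<le> M (\<lambda>x. of_bool (x \<in> A))" for A
    using assms by (simp add: mean_on_def)
  show "M (\<lambda>x. of_bool (x \<in> X)) = 1"
    using assms mean_on_cong[OF assms, of "\<lambda>x. of_bool (x \<in> X)" "\<lambda>_. 1"]
    by (simp add: mean_on_def)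
  show "M (\<lambda>x. of_bool (x \<in> A \<union> B)) = M (\<lambda>x. of_bool (x \<in> A)) + M (\<lambda>x. of_bool (x \<in> B))"
    if "A \<inter> B = {}" for A B
  proof -
    have "(\<lambda>x. of_bool (x \<in> A \<union> B)) = (\<lambda>x. of_bool (x \<in> A) + of_bool (x \<in> B) :: real)"
      using that by (auto simp: fun_eq_iff of_bool_def)
    then show ?thesis
      using assms by (simp add: mean_on_def)
  qed
qed

lemma (in comm_monoid) amenable_comm_monoid: "amenable G"
proof (rule amenable_if_almost_invariant)
  fix F :: "'a set" and e :: real
  assume "finite F" "F \<subseteq> carrier G" "0 < e"
  then obtain M where M: "mean_on (carrier G) M"
    and inv: "\<And>g f. g \<in> F \<Longrightarrow> (\<And>x. x \<in> carrier G \<Longrightarrow> f x \<in> {0..1}) \<Longrightarrow>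
      \<bar>M (\<lambda>x. f (g \<otimes> x)) - M f\<bar> \<le> e"
    using almost_invariant_mean by meson
  have "\<bar>M (\<lambda>x. of_bool (x \<in> {h \<in> carrier G. g \<otimes> h \<in> E})) - M (\<lambda>x. of_bool (x \<in> E))\<bar> \<le> e"
    if "g \<in> F" for g E
  proof -
    have "M (\<lambda>x. of_bool (x \<in> {h \<in> carrier G. g \<otimes> h \<in> E})) = M (\<lambda>x. of_bool (g \<otimes> x \<in> E))"
      by (rule mean_on_cong[OF M]) simp
    then show ?thesis
      using inv[OF that, of "\<lambda>x. of_bool (x \<in> E)"] by simp
  qed
  then show "\<exists>m. finitely_additive_prob (carrier G) m \<and>
      (\<forall>g\<in>F. \<forall>E\<subseteq>carrier G. \<bar>m {h \<in> carrier G. g \<otimes> h \<in> E} - m E\<bar> \<le> e)"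
    using mean_on_imp_finitely_additive_prob[OF M] by blast
qed

section \<open>Amenability of the affine semigroup\<close>

lemma affine_map_in_affine_semigroup:
  assumes "u \<in> carrier R - {\<zero>\<^bsub>R\<^esub>}" "v \<in> carrier R"
  shows "affine_map R u v \<in> carrier (affine_semigroup R)"
  using assms by (auto simp: affine_semigroup_def)

lemma affine_semigroupE:
  assumes "g \<in> carrier (affine_semigroup R)"
  obtains u v where "g = affine_map R u v" "u \<in> carrier R - {\<zero>\<^bsub>R\<^esub>}" "v \<in> carrier R"
  using assms by (auto simp: affine_semigroup_def)

lemma (in ring) affine_map_mult:
  assumes "a \<in> carrier R" "b \<in> carrier R" "c \<in> carrier R" "d \<in> carrier R"
  shows "affine_map R a b \<otimes>\<^bsub>affine_semigroup R\<^esub> affine_map R c d =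
    affine_map R (a \<otimes> c) (a \<otimes> d \<oplus> b)"
  using assms by (auto simp: affine_semigroup_def affine_map_def compose_def fun_eq_iff
      r_distr m_assoc a_assoc)

lemma (in ring) affine_map_zero:
  assumes "u \<in> carrier R" "v \<in> carrier R"
  shows "affine_map R u v \<zero> = v"
  using assms by (simp add: affine_map_def)

lemma (in domain) field_if_amenable_affine_semigroup:
  assumes "amenable (affine_semigroup R)"
  shows "field R"
proof (rule cring_fieldI, rule ccontr)
  let ?A = "affine_semigroup R"
  interpret A: monoid ?A by (rule monoid_affine_semigroup)
  assume "Units R \<noteq> carrier R - {\<zero>}"
  moreover have "Units R \<subseteq> carrier R - {\<zero>}"
    using Units_closed by (auto simp: Units_def)
  ultimately obtain u where u: "u \<in> carrier R" "u \<noteq> \<zero>" "u \<notin> Units R"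
    by blast
  obtain m where m: "finitely_additive_prob (carrier ?A) m"
    and inv: "\<And>g E. g \<in> carrier ?A \<Longrightarrow> E \<subseteq> carrier ?A \<Longrightarrow>
      m {h \<in> carrier ?A. g \<otimes>\<^bsub>?A\<^esub> h \<in> E} = m E"
    using assms unfolding amenable_def by blast
  define J where "J = (\<lambda>g. (\<otimes>\<^bsub>?A\<^esub>) g ` carrier ?A)"
  have J_sub: "J g \<subseteq> carrier ?A" if "g \<in> carrier ?A" for g
    using that by (auto simp: J_def)
  have J: "m (J g) = 1" if g: "g \<in> carrier ?A" for g
  proof -
    \<comment> \<open>Every product with left factor \<open>g\<close> lies in \<open>J g\<close>, so
      invariance compares \<open>J g\<close> with the whole semigroup.\<close>
    have "{h \<in> carrier ?A. g \<otimes>\<^bsub>?A\<^esub> h \<in> J g} = carrier ?A"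
      by (auto simp: J_def)
    then show ?thesis
      using inv[OF g J_sub[OF g]] m by (simp add: finitely_additive_prob_def)
  qed
  let ?f = "affine_map R u \<zero>" and ?g = "affine_map R u \<one>"
  have fg: "?f \<in> carrier ?A" "?g \<in> carrier ?A"
    using u by (auto intro: affine_map_in_affine_semigroup)
  have "J ?f \<inter> J ?g = {}"
  proof (rule ccontr)
    assume "J ?f \<inter> J ?g \<noteq> {}"
    then obtain h k where hk: "h \<in> carrier ?A" "k \<in> carrier ?A"
      and eq: "?f \<otimes>\<^bsub>?A\<^esub> h = ?g \<otimes>\<^bsub>?A\<^esub> k"
      by (auto simp: J_def)
    obtain a b where h: "h = affine_map R a b" "a \<in> carrier R" "b \<in> carrier R"
      using hk(1) by (blast elim: affine_semigroupE)
    obtain c d where k: "k = affine_map R c d" "c \<in> carrier R" "d \<in> carrier R"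
      using hk(2) by (blast elim: affine_semigroupE)
    \<comment> \<open>Evaluating at 0 leaves only the constant terms, which differ by a multiple of
      \<open>u\<close>; equality would invert \<open>u\<close>.\<close>
    have "u \<otimes> b = u \<otimes> d \<oplus> \<one>"
      using arg_cong[OF eq, of "\<lambda>p. p \<zero>"] h k u
      by (simp add: affine_map_mult affine_map_zero)
    then have "u \<otimes> (b \<ominus> d) = \<one>"
      using h k u by algebra
    then have "u \<in> Units R"
      using h k u m_comm[of u "b \<ominus> d"] by (auto simp: Units_def intro!: bexI[of _ "b \<ominus> d"])
    with u show False by simp
  qed
  then have "m (J ?f \<union> J ?g) = 2"
    using m J J_sub fg unfolding finitely_additive_prob_def by simp
  moreover have "m (J ?f \<union> J ?g) \<le> 1"
    using finitely_additive_prob_le_1[OF m] J_sub fg by simp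
  ultimately show False by simp
qed

text \<open>The two groups enter asymmetrically: on the additive group only sets are measured, so an
  exactly invariant measure will do, while on the multiplicative group functions are integrated, so
  an almost invariant mean is used.\<close>

lemma (in field) amenable_affine_semigroup: "amenable (affine_semigroup R)"
proof (rule amenable_if_almost_invariant)
  let ?A = "affine_semigroup R"
  have "amenable (add_monoid R)"
    by (rule add.amenable_comm_monoid)
  then obtain \<mu> where \<mu>: "finitely_additive_prob (carrier R) \<mu>"
    and transl: "\<And>c T. c \<in> carrier R \<Longrightarrow> T \<subseteq> carrier R \<Longrightarrow> \<mu> {v \<in> carrier R. c \<oplus> v \<in> T} = \<mu> T"
    unfolding amenable_def by auto
  interpret U: comm_group "units_of R" by (rule units_comm_group)
  have U: "carrier (units_of R) = carrier R - {\<zero>}"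
    by (simp add: units_of_def field_Units)
  \<comment> \<open>This is the measure of the fibre of \<open>E\<close> over the slope
    \<open>u\<close>. Writing the constant term as \<open>u\<close> times \<open>v\<close> makes
    left multiplication act on \<open>v\<close> by a translation.\<close>
  define \<Phi> where "\<Phi> = (\<lambda>E u. \<mu> {v \<in> carrier R. affine_map R u (u \<otimes> v) \<in> E})"
  fix F :: "('a \<Rightarrow> 'a) set" and e :: real
  assume F: "finite F" "F \<subseteq> carrier ?A" and "0 < e"
  have "\<exists>a b. g = affine_map R a b \<and> a \<in> carrier R - {\<zero>} \<and> b \<in> carrier R" if "g \<in> F" for g
    using that F by (blast elim: affine_semigroupE)
  then obtain a b where ab: "\<And>g. g \<in> F \<Longrightarrow> g = affine_map R (a g) (b g)"
    "\<And>g. g \<in> F \<Longrightarrow> a g \<in> carrier R - {\<zero>}" "\<And>g. g \<in> F \<Longrightarrow> b g \<in> carrier R"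
    by metis
  \<comment> \<open>Only the slopes need an almost invariant mean; the constant terms are absorbed
    exactly by \<open>\<mu>\<close>.\<close>
  have "finite (a ` F)" "a ` F \<subseteq> carrier (units_of R)"
    using F ab U by auto
  then obtain M where M: "mean_on (carrier R - {\<zero>}) M"
    and inv: "\<And>g f. g \<in> F \<Longrightarrow> (\<And>u. u \<in> carrier R - {\<zero>} \<Longrightarrow> f u \<in> {0..1}) \<Longrightarrow>
      \<bar>M (\<lambda>u. f (a g \<otimes> u)) - M f\<bar> \<le> e"
    using U.almost_invariant_mean[OF _ _ \<open>0 < e\<close>, of "a ` F"]
    by (auto simp: U units_of_mult)
  have \<Phi>_range: "\<Phi> E u \<in> {0..1}" for E u
    using \<mu> finitely_additive_prob_le_1[OF \<mu>]
    by (auto simp: \<Phi>_def finitely_additive_prob_def)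
  define m where "m = (\<lambda>E. M (\<Phi> E))"
  have "finitely_additive_prob (carrier ?A) m"
    unfolding finitely_additive_prob_def
  proof (intro conjI allI impI)
    show "0 \<le> m E" for E
      using M \<Phi>_range by (auto simp: m_def mean_on_def)
    have "\<Phi> (carrier ?A) u = 1" if "u \<in> carrier R - {\<zero>}" for u
    proof -
      have "{v \<in> carrier R. affine_map R u (u \<otimes> v) \<in> carrier ?A} = carrier R"
        using that affine_map_in_affine_semigroup[of u R] by auto
      then show ?thesis
        using \<mu> by (simp add: \<Phi>_def finitely_additive_prob_def)
    qed
    then show "m (carrier ?A) = 1"
      using M mean_on_cong[OF M, of "\<Phi> (carrier ?A)" "\<lambda>_. 1"] by (simp add: m_def mean_on_def)
    fix E E' :: "('a \<Rightarrow> 'a) set"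
    assume "E \<inter> E' = {}"
    have "\<Phi> (E \<union> E') u = \<Phi> E u + \<Phi> E' u" for u
    proof -
      let ?T = "\<lambda>E. {v \<in> carrier R. affine_map R u (u \<otimes> v) \<in> E}"
      have "?T (E \<union> E') = ?T E \<union> ?T E'" "?T E \<inter> ?T E' = {}"
        using \<open>E \<inter> E' = {}\<close> by auto
      moreover have "?T E \<subseteq> carrier R" "?T E' \<subseteq> carrier R"
        by auto
      ultimately show ?thesis
        using \<mu> unfolding \<Phi>_def finitely_additive_prob_def by simp
    qed
    then have "\<Phi> (E \<union> E') = (\<lambda>u. \<Phi> E u + \<Phi> E' u)" by (rule ext)
    then show "m (E \<union> E') = m E + m E'"
      using M by (simp add: m_def mean_on_def)
  qed
  moreover have "\<bar>m {h \<in> carrier ?A. g \<otimes>\<^bsub>?A\<^esub> h \<in> E} - m E\<bar> \<le> e" if g: "g \<in> F" for g E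
  proof -
    let ?a = "a g" and ?b = "b g"
    note ab = ab[OF g]
    have "\<Phi> {h \<in> carrier ?A. g \<otimes>\<^bsub>?A\<^esub> h \<in> E} u = \<Phi> E (?a \<otimes> u)" if u: "u \<in> carrier R - {\<zero>}" for u
    proof -
      have au: "?a \<otimes> u \<in> carrier R - {\<zero>}"
        using u ab integral by auto
      then have unit: "?a \<otimes> u \<in> Units R"
        by (simp add: field_Units)
      \<comment> \<open>This \<open>c\<close> solves auc = b, so au(x + v) + b = au(x + (c + v)):
        the fibre over \<open>u\<close> becomes the one over au, translated by
        \<open>c\<close>.\<close>
      define c where "c = inv (?a \<otimes> u) \<otimes> ?b"
      have c: "c \<in> carrier R"
        using unit ab by (simp add: c_def)
      have "(?a \<otimes> u) \<otimes> c = ?b"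
        using unit au ab by (simp add: c_def flip: m_assoc)
      then have "affine_map R ?a ?b \<otimes>\<^bsub>?A\<^esub> affine_map R u (u \<otimes> v) =
        affine_map R (?a \<otimes> u) ((?a \<otimes> u) \<otimes> (c \<oplus> v))" if "v \<in> carrier R" for v
        using that u ab(2,3) c au by (simp add: affine_map_mult r_distr m_assoc a_comm)
      then have mult: "g \<otimes>\<^bsub>?A\<^esub> affine_map R u (u \<otimes> v) =
        affine_map R (?a \<otimes> u) ((?a \<otimes> u) \<otimes> (c \<oplus> v))" if "v \<in> carrier R" for v
        using that by (simp flip: ab(1))
      let ?T = "{w \<in> carrier R. affine_map R (?a \<otimes> u) ((?a \<otimes> u) \<otimes> w) \<in> E}"
      have "{v \<in> carrier R. affine_map R u (u \<otimes> v) \<in> {h \<in> carrier ?A. g \<otimes>\<^bsub>?A\<^esub> h \<in> E}} =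
        {v \<in> carrier R. c \<oplus> v \<in> ?T}"
        using u c affine_map_in_affine_semigroup[of u R] by (auto simp: mult)
      then show ?thesis
        using transl[OF c, of ?T] by (simp add: \<Phi>_def)
    qed
    then have "m {h \<in> carrier ?A. g \<otimes>\<^bsub>?A\<^esub> h \<in> E} = M (\<lambda>u. \<Phi> E (?a \<otimes> u))"
      unfolding m_def by (rule mean_on_cong[OF M])
    then show ?thesis
      using inv[OF g, of "\<Phi> E"] \<Phi>_range by (simp add: m_def)
  qed
  ultimately show "\<exists>m. finitely_additive_prob (carrier ?A) m \<and>
      (\<forall>g\<in>F. \<forall>E\<subseteq>carrier ?A. \<bar>m {h \<in> carrier ?A. g \<otimes>\<^bsub>?A\<^esub> h \<in> E} - m E\<bar> \<le> e)"
    by blast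
qed

theorem proposition2p4:
  fixes R :: "('a, 'm) ring_scheme"
  assumes "domain R" and "countable (carrier R)"
  shows "amenable (affine_semigroup R) \<longleftrightarrow> field R"
  using domain.field_if_amenable_affine_semigroup[OF assms(1)] field.amenable_affine_semigroup
  by blast

end
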